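(* Let $C_R^*=\mathcal{L}^*\cap\{z\in\mathbb{H}:d(i,z)\le R\}$. Every $w\in\mathcal{L}^*$ with $d(i,w)>R$ is eclipsed by some $z_\epsilon$ with $z\in C_R^*$ if and only if $\epsilon\ge \log(1+\sqrt{2})$.
   Context: $\mathbb{H}$ is the upper half-plane with the Poincaré metric $ds^2=y^{-2}(dx^2+dy^2)$ and $d$ is the corresponding hyperbolic distance; $\mathrm{SL}_2(\mathbb{Z})$ acts on $\mathbb{H}$ by fractional linear transformations. $\mathcal{L}=\{\gamma(i):\gamma\in \mathrm{SL}_2(\mathbb{Z})\}$ and $\mathcal{L}^*=\mathcal{L}\setminus\{i\}$. $R>0$ is a radius. For $z\in\mathcal{L}^*$ and $\epsilon>0$, $z_\epsilon=\{u\in\mathbb{H}: d(u,z)\le\epsilon\}$. For $z,w\in\mathcal{L}^*$, $z_\epsilon$ eclipses $w$ if $r\cap z_\epsilon\ne\emptyset$, where $r$ is the geodesic arc connecting $i$ and $w$.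
   Formalization: The formal statement assumes that C_R^* is nonempty (equivalently cosh R ≥ 3/2); for smaller R the claim fails, since C_R^* is empty and w = 1+i, with d(i,w) > R, is eclipsed by nothing for any ε. *)

theory Defs
  imports "HOL-Analysis.Analysis"
begin

definition upper_half_plane :: "complex set" where
  "upper_half_plane = {z. Im z > 0}"

text \<open>Having hyperbolic length \<open>l\<close> is a relation, not a function: the derivative of a piecewise
  \<open>C\<^sup>1\<close> path in the sense of \<open>valid_path\<close> may be unbounded near the finitely many exceptional
  parameters, and the total function \<open>integral\<close> would give a path of infinite length
  the value 0.\<close>

definition has_hyp_length :: "(real \<Rightarrow> complex) \<Rightarrow> real \<Rightarrow> bool" where
  "has_hyp_length g l \<longleftrightarrow>
     ((\<lambda>t. norm (vector_derivative g (at t)) / Im (g t)) has_integral l) {0..1}"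

definition hyp_dist :: "complex \<Rightarrow> complex \<Rightarrow> real" where
  "hyp_dist z w = Inf {l. \<exists>g. valid_path g \<and> path_image g \<subseteq> upper_half_plane \<and>
     pathstart g = z \<and> pathfinish g = w \<and> has_hyp_length g l}"

text \<open>A geodesic arc is the image of a unit-speed minimizing geodesic, i.e. of an isometric
  embedding of a compact interval. In the hyperbolic plane there is exactly one such arc
  between two given points.\<close>

definition is_geodesic_arc :: "complex set \<Rightarrow> complex \<Rightarrow> complex \<Rightarrow> bool" where
  "is_geodesic_arc r z w \<longleftrightarrow>
     (\<exists>c. c ` {0..hyp_dist z w} = r \<and> r \<subseteq> upper_half_plane \<and>
          c 0 = z \<and> c (hyp_dist z w) = w \<and>
          (\<forall>s\<in>{0..hyp_dist z w}. \<forall>t\<in>{0..hyp_dist z w}. hyp_dist (c s) (c t) = \<bar>s - t\<bar>))"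

definition SL2Z :: "(int^2^2) set" where
  "SL2Z = {A. det A = 1}"

definition moebius_act :: "int^2^2 \<Rightarrow> complex \<Rightarrow> complex" where
  "moebius_act A z = (of_int (A $ 1 $ 1) * z + of_int (A $ 1 $ 2)) /
                     (of_int (A $ 2 $ 1) * z + of_int (A $ 2 $ 2))"

definition orbit_i :: "complex set" where
  "orbit_i = {moebius_act A \<i> | A. A \<in> SL2Z}"

definition orbit_i_star :: "complex set" where
  "orbit_i_star = orbit_i - {\<i>}"

definition C_star :: "real \<Rightarrow> complex set" where
  "C_star R = orbit_i_star \<inter> {z \<in> upper_half_plane. hyp_dist \<i> z \<le> R}"

definition hyp_cball :: "complex \<Rightarrow> real \<Rightarrow> complex set" where
  "hyp_cball z \<epsilon> = {u \<in> upper_half_plane. hyp_dist u z \<le> \<epsilon>}"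

definition eclipses :: "complex \<Rightarrow> real \<Rightarrow> complex \<Rightarrow> bool" where
  "eclipses z \<epsilon> w \<longleftrightarrow> (\<exists>r. is_geodesic_arc r \<i> w \<and> r \<inter> hyp_cball z \<epsilon> \<noteq> {})"

text \<open>If \<open>R\<close> is smaller than the distance from \<open>\<i>\<close> to its nearest orbit points, then \<open>C_star R\<close> is
  empty and no value of \<open>\<epsilon>\<close> suffices. Hence a threshold for \<open>\<epsilon>\<close> can only be
  claimed when \<open>C_star R\<close> is nonempty.\<close>

lemma not_all_eclipsed_if_C_star_empty:
  assumes "C_star R = {}"
  shows "\<not> (\<forall>w\<in>orbit_i_star. hyp_dist \<i> w > R \<longrightarrow> (\<exists>z\<in>C_star R. eclipses z \<epsilon> w))"
proof -
  define A :: "int^2^2" where "A = (\<chi> i j. if i = 2 \<and> j = 1 then 0 else 1)"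
  have "A \<in> SL2Z"
    by (simp add: SL2Z_def A_def det_2)
  moreover have "moebius_act A \<i> = \<i> + 1"
    by (simp add: moebius_act_def A_def)
  ultimately have w: "\<i> + 1 \<in> orbit_i_star"
    by (force simp: orbit_i_star_def orbit_i_def)
  then have "hyp_dist \<i> (\<i> + 1) > R"
    using assms by (force simp: C_star_def upper_half_plane_def)
  with w assms show ?thesis
    by blast
qed

end

theory Submission
  imports Defs
begin

text \<open>
  The point \<open>x + iy\<close> is represented by its hyperboloid coordinates
  \<open>(1/y, x/y, (x\<^sup>2 + y\<^sup>2)/y)\<close>. For the Lorentzian form \<open>mink\<close> these are future unit vectors,
  and the form of two of them is the hyperbolic cosine of the hyperbolic distance
  (\<open>cosh_hyp_dist\<close>). An orbit point other than \<open>\<i>\<close> has integral coordinates \<open>(m, k, p)\<close>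
  with \<open>m p = k\<^sup>2 + 1\<close> and \<open>k \<noteq> 0\<close> (\<open>orbit_i_starE\<close>). All of the geometry
  becomes linear algebra with this form.

  Sufficiency. The four orbit points nearest to \<open>\<i>\<close> are \<open>\<plusminus>1 + \<i>\<close> and \<open>(\<plusminus>1 + \<i>)/2\<close>, at
  distance \<open>arcosh (3/2)\<close>. By \<open>orbit_i_star_cosh_ge\<close> they all belong to \<open>C_star R\<close> once this
  set is nonempty. A geodesic ray from \<open>\<i>\<close> with unit direction \<open>V\<close> sees the point in its own
  quadrant, at time \<open>t\<close>, at a distance with hyperbolic cosine at most
  \<open>3/2 cosh t - 1/2 sinh t\<close>. The minimum \<open>\<surd>2\<close> is attained at \<open>t = (ln 2)/2\<close>
  (\<open>ray_meets_ball_of_nearest\<close>), and \<open>\<surd>2 = cosh (ln (1 + \<surd>2))\<close>. The time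
  \<open>(ln 2)/2\<close> is smaller than \<open>arcosh (3/2)\<close>, so that the arc to any \<open>w\<close> farther than \<open>R\<close>
  is long enough to contain this point.

  Necessity. The distance of an orbit point \<open>(m, k, p)\<close> to the imaginary axis is
  \<open>arsinh \<bar>k\<bar>\<close>, and \<open>k\<close> is a nonzero integer, so this distance is at least
  \<open>arsinh 1 = ln (1 + \<surd>2)\<close>: no smaller ball about an orbit point meets the axis. The arcs
  from \<open>\<i>\<close> to the orbit points \<open>n + \<i>\<close> approach the axis locally uniformly as \<open>n\<close> grows
  (\<open>geodesic_to_translate\<close>), and only their part within distance \<open>R + \<epsilon>\<close> of \<open>\<i>\<close> can meet a ball
  about a point of \<open>C_star R\<close>. Hence for \<open>\<epsilon> < ln (1 + \<surd>2)\<close> and large \<open>n\<close> the point \<open>n + \<i>\<close>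
  is not eclipsed (\<open>mink_ge_near_axis\<close>, \<open>not_all_eclipsed_if_less\<close>).

  That the infimum of path lengths is \<open>arcosh\<close> of the form is \<open>hyp_dist_eq\<close>. The
  geodesic \<open>cosh t X + sinh t V\<close> gives the upper bound. For the lower bound,
  the logarithm of \<open>mink N\<close>, where \<open>N = X + V\<close> is the null vector at the end of the geodesic,
  is (up to sign) a Busemann function. It changes with slope at most \<open>1\<close>
  with respect to hyperbolic length, and with slope exactly \<open>1\<close> along the geodesic.
\<close>

section \<open>The hyperboloid model\<close>

text \<open>The polarisation of the determinant \<open>a c - b\<^sup>2\<close> of the symmetric \<open>2 \<times> 2\<close> matrix with
  entries \<open>a, b, b, c\<close>. It has signature \<open>(1, 2)\<close>. The time orientation is read off from the sign of
  the first component.\<close>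

definition mink :: "real \<times> real \<times> real \<Rightarrow> real \<times> real \<times> real \<Rightarrow> real" where
  "mink X Y = (fst X * snd (snd Y) + fst Y * snd (snd X)) / 2 - fst (snd X) * fst (snd Y)"

definition lift :: "complex \<Rightarrow> real \<times> real \<times> real" where
  "lift z = (1 / Im z, Re z / Im z, ((Re z)\<^sup>2 + (Im z)\<^sup>2) / Im z)"

definition unlift :: "real \<times> real \<times> real \<Rightarrow> complex" where
  "unlift X = Complex (fst (snd X) / fst X) (1 / fst X)"

lemma mink_add_left: "mink (X + Y) Z = mink X Z + mink Y Z"
  and mink_add_right: "mink Z (X + Y) = mink Z X + mink Z Y"
  and mink_diff_left: "mink (X - Y) Z = mink X Z - mink Y Z"
  and mink_diff_right: "mink Z (X - Y) = mink Z X - mink Z Y"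
  and mink_scaleR_left: "mink (r *\<^sub>R X) Z = r * mink X Z"
  and mink_scaleR_right: "mink Z (r *\<^sub>R X) = r * mink Z X"
  by (simp_all add: mink_def field_simps)

lemmas mink_bilinear = mink_add_left mink_add_right mink_diff_left mink_diff_right
  mink_scaleR_left mink_scaleR_right

lemma mink_commute: "mink X Y = mink Y X"
  by (simp add: mink_def algebra_simps)

lemma fst_lift_pos: "Im z > 0 \<Longrightarrow> fst (lift z) > 0"
  by (simp add: lift_def)

lemma mink_lift_lift:
  assumes "Im z > 0" "Im w > 0"
  shows "mink (lift z) (lift w) = 1 + (dist z w)\<^sup>2 / (2 * Im z * Im w)"
  using assms
  by (simp add: mink_def lift_def dist_complex_def cmod_power2 field_simps)
     (simp add: power2_eq_square algebra_simps)

lemma mink_lift_self: "Im z > 0 \<Longrightarrow> mink (lift z) (lift z) = 1"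
  by (simp add: mink_lift_lift)

lemma unlift_lift: "Im z > 0 \<Longrightarrow> unlift (lift z) = z"
  by (simp add: lift_def unlift_def complex_eq_iff)

lemma lift_unlift:
  assumes "mink X X = 1" "fst X > 0"
  shows "lift (unlift X) = X"
proof -
  have "snd (snd X) = (1 + (fst (snd X))\<^sup>2) / fst X"
    using assms by (simp add: mink_def field_simps power2_eq_square)
  then show ?thesis
    using assms(2)
    by (auto simp: lift_def unlift_def prod_eq_iff power_divide)
       (simp add: field_simps power2_eq_square)
qed

lemma Im_unlift_pos: "fst X > 0 \<Longrightarrow> Im (unlift X) > 0"
  by (simp add: unlift_def)

text \<open>For fixed null \<open>N\<close> the form \<open>mink N\<close> has a constant sign on the sheet of future unit
  vectors. When the first component of \<open>N\<close> is nonzero, that sign can be read off from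
  this sum of squares.\<close>

lemma null_vector_identity:
  assumes "mink N N = 0" "mink X X = 1"
  shows "2 * fst X * (fst N * mink N X) = (fst X * fst (snd N) - fst N * fst (snd X))\<^sup>2 + (fst N)\<^sup>2"
proof -
  obtain \<alpha> \<beta> \<gamma> a b c where eq: "N = (\<alpha>, \<beta>, \<gamma>)" "X = (a, b, c)"
    by (cases N, cases X) auto
  have n: "\<alpha> * \<gamma> = \<beta>\<^sup>2" and x: "a * c = 1 + b\<^sup>2"
    using assms by (simp_all add: mink_def eq power2_eq_square)
  have "2 * a * (\<alpha> * ((\<alpha> * c + a * \<gamma>) / 2 - \<beta> * b)) = \<alpha>\<^sup>2 * (a * c) + a\<^sup>2 * (\<alpha> * \<gamma>) - 2 * a * \<alpha> * \<beta> * b"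
    by (simp add: field_simps power2_eq_square)
  also have "\<dots> = (a * \<beta> - \<alpha> * b)\<^sup>2 + \<alpha>\<^sup>2"
    unfolding n x by (simp add: field_simps power2_eq_square)
  finally show ?thesis
    by (simp add: eq mink_def)
qed

lemma null_vector_fst_nonneg:
  assumes "mink N N = 0" "mink N X > 0" "mink X X = 1" "fst X > 0"
  shows "fst N \<ge> 0"
proof -
  have "2 * fst X * (fst N * mink N X) \<ge> 0"
    unfolding null_vector_identity[OF assms(1,3)] by simp
  then show ?thesis
    using assms(2,4) by (simp add: zero_le_mult_iff)
qed

text \<open>If the first component of \<open>N\<close> vanishes, so does the second, and \<open>N\<close> is the point at
  infinity of the half-plane, for which the form is a multiple of the first component.\<close>

lemma null_vector_pos:
  assumes N: "mink N N = 0" "mink N X > 0" and X: "mink X X = 1" "fst X > 0"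
    and Y: "mink Y Y = 1" "fst Y > 0"
  shows "mink N Y > 0"
proof (cases "fst N = 0")
  case True
  then have "fst (snd N) = 0"
    using N(1) by (simp add: mink_def)
  then have "mink N Z = fst Z * snd (snd N) / 2" for Z
    using True by (simp add: mink_def)
  then show ?thesis
    using N(2) X(2) Y(2) by (metis zero_less_mult_pos mult_pos_pos half_gt_zero_iff)
next
  case False
  then have "fst N > 0"
    using null_vector_fst_nonneg[OF N X] by simp
  moreover have "2 * fst Y * (fst N * mink N Y) > 0"
    unfolding null_vector_identity[OF N(1) Y(1)] using False
    by (simp add: add_nonneg_pos)
  ultimately show ?thesis
    using Y(2) by (simp add: zero_less_mult_iff)
qed

section \<open>Geodesics\<close>

definition ray :: "real \<times> real \<times> real \<Rightarrow> real \<times> real \<times> real \<Rightarrow> real \<Rightarrow> real \<times> real \<times> real" where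
  "ray X V t = cosh t *\<^sub>R X + sinh t *\<^sub>R V"

definition unit_tangent :: "real \<times> real \<times> real \<Rightarrow> real \<times> real \<times> real \<Rightarrow> bool" where
  "unit_tangent X V \<longleftrightarrow> mink X X = 1 \<and> fst X > 0 \<and> mink X V = 0 \<and> mink V V = -1"

lemma mink_ray_ray:
  assumes "unit_tangent X V"
  shows "mink (ray X V s) (ray X V t) = cosh (s - t)"
  using assms
  by (simp add: unit_tangent_def ray_def mink_bilinear mink_commute[of V X] cosh_diff)

text \<open>The null vectors \<open>X + V\<close> and \<open>X - V\<close> at both ends of the geodesic are future pointing, and the
  ray is a positive combination of them.\<close>

lemma fst_ray_pos:
  assumes "unit_tangent X V"
  shows "fst (ray X V t) > 0"
proof -
  have X: "mink X X = 1" "fst X > 0" and V: "mink X V = 0" "mink V V = -1"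
    using assms by (simp_all add: unit_tangent_def)
  have "fst (X + V) \<ge> 0" "fst (X - V) \<ge> 0"
    by (rule null_vector_fst_nonneg[OF _ _ X];
        simp add: mink_bilinear X V mink_commute[of V X])+
  then have *: "\<bar>fst V\<bar> \<le> fst X"
    by auto
  have "\<bar>sinh t * fst V\<bar> \<le> \<bar>sinh t\<bar> * fst X"
    using * by (simp add: abs_mult mult_left_mono)
  also have "\<dots> < cosh t * fst X"
  proof -
    have "\<bar>sinh t\<bar> < cosh t"
      using sinh_less_cosh_real[of t] sinh_less_cosh_real[of "-t"] by auto
    then show ?thesis using X(2) by simp
  qed
  finally show ?thesis
    by (simp add: ray_def abs_less_iff)
qed

text \<open>The tangent vector is the normalised component of \<open>Y\<close> orthogonal to \<open>X\<close>.\<close>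

lemma ray_connecting:
  assumes X: "mink X X = 1" "fst X > 0" and Y: "mink Y Y = 1" and "mink X Y = cosh L" "L > 0"
  obtains V where "unit_tangent X V" "ray X V L = Y"
proof -
  define V where "V = (1 / sinh L) *\<^sub>R (Y - cosh L *\<^sub>R X)"
  have s: "sinh L > 0" using assms by simp
  have "mink V V = (1 - (cosh L)\<^sup>2) / (sinh L)\<^sup>2"
    by (simp add: V_def mink_bilinear mink_commute[of Y X] X Y assms(4) power2_eq_square)
  then have "mink V V = -1"
    using s by (simp add: cosh_square_eq)
  moreover have "mink X V = 0"
    by (simp add: V_def mink_bilinear X assms(4))
  moreover have "ray X V L = Y"
    using s by (simp add: V_def ray_def)
  ultimately show ?thesis
    using X that by (auto simp: unit_tangent_def)
qed

lemma ray_tangent_relations: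
  assumes "unit_tangent X V"
  shows "mink (ray X V t) (sinh t *\<^sub>R X + cosh t *\<^sub>R V) = 0"
    and "mink (sinh t *\<^sub>R X + cosh t *\<^sub>R V) (sinh t *\<^sub>R X + cosh t *\<^sub>R V) = -1"
  using assms cosh_square_eq[of t]
  by (simp_all add: unit_tangent_def ray_def mink_bilinear mink_commute[of V X] power2_eq_square)

text \<open>In the half-plane the curve with coordinates \<open>(a, b, c)\<close> is \<open>b/a + \<i>/a\<close>. This is
  the condition that it has unit hyperbolic speed, from the orthonormality of its
  position and velocity in the Lorentzian sense.\<close>

lemma unlift_speed:
  assumes "mink (a, b, c) (a, b, c) = 1" "mink (a, b, c) (a', b', c') = 0"
    "mink (a', b', c') (a', b', c') = -1" "a > 0"
  shows "(b' * a - b * a')\<^sup>2 + a'\<^sup>2 = a\<^sup>2"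
proof -
  have c: "a * c = 1 + b\<^sup>2" and c': "a * c' + a' * c = 2 * b * b'" and n: "a' * c' = b'\<^sup>2 - 1"
    using assms by (simp_all add: mink_def power2_eq_square field_simps)
  have "a\<^sup>2 * (a' * c') = a' * (a * (a * c' + a' * c)) - a'\<^sup>2 * (a * c)"
    by (simp add: algebra_simps power2_eq_square)
  then have "a\<^sup>2 * (b'\<^sup>2 - 1) = a' * (a * (2 * b * b')) - a'\<^sup>2 * (1 + b\<^sup>2)"
    unfolding c c' n .
  then show ?thesis
    by (simp add: algebra_simps power2_eq_square)
qed

definition geod :: "real \<times> real \<times> real \<Rightarrow> real \<times> real \<times> real \<Rightarrow> real \<Rightarrow> complex" where
  "geod X V t = unlift (ray X V t)"

lemma Im_geod_pos: "unit_tangent X V \<Longrightarrow> Im (geod X V t) > 0"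
  by (simp add: geod_def Im_unlift_pos fst_ray_pos)

lemma lift_geod: "unit_tangent X V \<Longrightarrow> lift (geod X V t) = ray X V t"
  by (simp add: geod_def lift_unlift fst_ray_pos mink_ray_ray)

lemma geod_unit_speed:
  assumes "unit_tangent X V"
  obtains D where "\<And>t. (geod X V has_vector_derivative D t) (at t)"
    "\<And>t. norm (D t) = Im (geod X V t)" "continuous_on UNIV D"
proof -
  obtain a0 b0 c0 va vb vc where eq: "X = (a0, b0, c0)" "V = (va, vb, vc)"
    by (cases X, cases V) auto
  define a where "a = (\<lambda>t. cosh t * a0 + sinh t * va)"
  define b where "b = (\<lambda>t. cosh t * b0 + sinh t * vb)"
  define a' where "a' = (\<lambda>t. sinh t * a0 + cosh t * va)"
  define b' where "b' = (\<lambda>t. sinh t * b0 + cosh t * vb)"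
  have apos: "a t > 0" for t
    using fst_ray_pos[OF assms, of t] by (simp add: ray_def eq a_def)
  have geod: "geod X V = (\<lambda>t. Complex (b t / a t) (1 / a t))"
    by (simp add: geod_def unlift_def ray_def eq a_def b_def fun_eq_iff)
  have speed: "(b' t * a t - b t * a' t)\<^sup>2 + (a' t)\<^sup>2 = (a t)\<^sup>2" for t
    using unlift_speed[of "a t" "b t" "cosh t * c0 + sinh t * vc" "a' t" "b' t" "sinh t * c0 + cosh t * vc"]
      ray_tangent_relations[OF assms, of t] mink_ray_ray[OF assms, of t t] apos[of t]
    by (simp add: ray_def eq a_def b_def a'_def b'_def)
  define D where "D = (\<lambda>t. Complex ((b' t * a t - b t * a' t) / (a t)\<^sup>2) (- a' t / (a t)\<^sup>2))"
  have der: "(a has_real_derivative a' t) (at t)" "(b has_real_derivative b' t) (at t)" for t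
    unfolding a_def b_def a'_def b'_def by (auto intro!: derivative_eq_intros)
  have "(geod X V has_vector_derivative D t) (at t)" for t
    unfolding has_vector_derivative_complex_iff geod D_def using apos[of t]
    by (auto intro!: derivative_eq_intros der simp: power2_eq_square)
  moreover have "norm (D t) = Im (geod X V t)" for t
  proof -
    have "(norm (D t))\<^sup>2 = ((b' t * a t - b t * a' t)\<^sup>2 + (a' t)\<^sup>2) / (a t)^4"
      by (simp add: D_def cmod_power2 power_divide add_divide_distrib)
    also have "\<dots> = (1 / a t)\<^sup>2"
      unfolding speed using apos[of t] by (simp add: power_divide power2_eq_square power4_eq_xxxx)
    finally show ?thesis
      using apos[of t] by (simp add: geod power2_eq_iff_nonneg)
  qed
  moreover have "continuous_on UNIV D"
    unfolding D_def Complex_eq using apos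
    by (intro continuous_intros ballI) (auto simp: a_def b_def a'_def b'_def less_le intro!: continuous_intros)
  ultimately show ?thesis
    by (rule that)
qed


section \<open>The distance formula\<close>

text \<open>In the half-plane \<open>\<phi> = mink N \<circ> lift\<close> satisfies
  \<open>y\<^sup>2 \<bar>grad \<phi>\<bar>\<^sup>2 = \<phi>\<^sup>2 - mink N N\<close>. So for null \<open>N\<close> the gradient of \<open>ln \<phi>\<close> has hyperbolic norm \<open>1\<close>,
  and the bound is the Cauchy-Schwarz inequality.\<close>

lemma log_null_form_derivative:
  assumes N: "mink N N = 0" "mink N (lift (g t)) > 0"
    and g: "(g has_vector_derivative g') (at t)" "Im (g t) > 0"
  obtains h' where "((\<lambda>t. ln (mink N (lift (g t)))) has_real_derivative h') (at t)"
    "\<bar>h'\<bar> \<le> norm g' / Im (g t)"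
proof -
  obtain \<alpha> \<beta> \<gamma> where eq: "N = (\<alpha>, \<beta>, \<gamma>)"
    by (cases N) auto
  have n: "\<alpha> * \<gamma> = \<beta>\<^sup>2"
    using N(1) by (simp add: mink_def eq power2_eq_square)
  define x where "x = (\<lambda>t. Re (g t))"
  define y where "y = (\<lambda>t. Im (g t))"
  define \<phi> where "\<phi> = (\<lambda>t. mink N (lift (g t)))"
  have \<phi>: "\<phi> = (\<lambda>t. (\<alpha> * ((x t)\<^sup>2 + (y t)\<^sup>2) / y t + \<gamma> / y t) / 2 - \<beta> * x t / y t)"
    by (simp add: \<phi>_def mink_def eq lift_def x_def y_def fun_eq_iff)
  have y: "y t > 0" and \<phi>pos: "\<phi> t > 0"
    using g N by (simp_all add: y_def \<phi>_def)
  have dx: "(x has_real_derivative Re g') (at t)" and dy: "(y has_real_derivative Im g') (at t)"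
    using g(1) by (simp_all add: has_vector_derivative_complex_iff x_def y_def)
  define p where "p = (\<alpha> * x t - \<beta>) / y t"
  define q where "q = \<alpha> - \<phi> t / y t"
  have d\<phi>: "(\<phi> has_real_derivative p * Re g' + q * Im g') (at t)"
    unfolding \<phi> p_def q_def using y
    by (auto intro!: derivative_eq_intros dx dy) (simp add: field_simps power2_eq_square)
  \<comment> \<open>\<open>(p, q)\<close> is the Euclidean gradient of \<open>\<phi>\<close>.\<close>
  have pq: "p\<^sup>2 + q\<^sup>2 = (\<phi> t / y t)\<^sup>2"
  proof -
    have "2 * y t * \<phi> t = \<alpha> * ((x t)\<^sup>2 + (y t)\<^sup>2) + \<gamma> - 2 * \<beta> * x t"
      using y by (simp add: \<phi> field_simps)
    then have "\<alpha> * (2 * y t * \<phi> t) = \<alpha> * (\<alpha> * ((x t)\<^sup>2 + (y t)\<^sup>2) + \<gamma> - 2 * \<beta> * x t)"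
      by simp
    then have "(\<alpha> * x t - \<beta>)\<^sup>2 + (\<alpha> * y t - \<phi> t)\<^sup>2 = (\<phi> t)\<^sup>2"
      using n by (simp add: algebra_simps power2_eq_square)
    moreover have "p\<^sup>2 + q\<^sup>2 = ((\<alpha> * x t - \<beta>)\<^sup>2 + (\<alpha> * y t - \<phi> t)\<^sup>2) / (y t)\<^sup>2"
      using y by (simp add: p_def q_def field_simps power2_eq_square)
    ultimately show ?thesis
      by (simp add: power_divide)
  qed
  have "(p * Re g' + q * Im g')\<^sup>2 \<le> (p\<^sup>2 + q\<^sup>2) * ((Re g')\<^sup>2 + (Im g')\<^sup>2)"
    using zero_le_power2[of "p * Im g' - q * Re g'"]
    by (simp add: algebra_simps power2_eq_square)
  also have "\<dots> = (\<phi> t / y t * norm g')\<^sup>2"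
    unfolding pq power_mult_distrib cmod_power2 ..
  finally have "\<bar>p * Re g' + q * Im g'\<bar> \<le> \<bar>\<phi> t / y t * norm g'\<bar>"
    by (simp only: abs_le_square_iff)
  also have "\<dots> = \<phi> t / y t * norm g'"
    using y \<phi>pos by (simp only: abs_of_nonneg norm_ge_zero mult_nonneg_nonneg divide_nonneg_pos less_imp_le)
  finally have "\<bar>p * Re g' + q * Im g'\<bar> \<le> \<phi> t / y t * norm g'" .
  then have "\<bar>(p * Re g' + q * Im g') / \<phi> t\<bar> \<le> norm g' / Im (g t)"
    using \<phi>pos y by (simp add: abs_divide field_simps y_def)
  moreover have "((\<lambda>t. ln (\<phi> t)) has_real_derivative (p * Re g' + q * Im g') / \<phi> t) (at t)"
    using \<phi>pos by (auto intro!: derivative_eq_intros d\<phi>)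
  ultimately show ?thesis
    using that by (simp add: \<phi>_def)
qed

text \<open>A path in \<open>valid_path\<close> may have finitely many corners. They do not affect
  either integral.\<close>

lemma length_ge_log_null_form:
  assumes N: "mink N N = 0" "\<And>z. Im z > 0 \<Longrightarrow> mink N (lift z) > 0"
    and g: "valid_path g" "path_image g \<subseteq> upper_half_plane" "has_hyp_length g l"
  shows "ln (mink N (lift (pathstart g))) - ln (mink N (lift (pathfinish g))) \<le> l"
proof -
  define h where "h = (\<lambda>t. ln (mink N (lift (g t))))"
  obtain S where S: "finite S" "g C1_differentiable_on {0..1} - S" and cont: "continuous_on {0..1} g"
    using g(1) by (auto simp: valid_path_def piecewise_C1_differentiable_on_def)
  have Im: "Im (g t) > 0" if "t \<in> {0..1}" for t
    using g(2) that by (auto simp: path_image_def upper_half_plane_def image_subset_iff)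
  have "\<exists>D. (h has_real_derivative D) (at t) \<and>
      \<bar>D\<bar> \<le> norm (vector_derivative g (at t)) / Im (g t)" if "t \<in> {0..1} - S" for t
  proof -
    have "(g has_vector_derivative vector_derivative g (at t)) (at t)"
      using S(2) that by (simp add: C1_differentiable_on_eq vector_derivative_works)
    moreover have "Im (g t) > 0"
      using Im that by simp
    ultimately show ?thesis
      using log_null_form_derivative[OF N(1) N(2)] unfolding h_def by metis
  qed
  then obtain h' where h': "\<And>t. t \<in> {0..1} - S \<Longrightarrow> (h has_real_derivative h' t) (at t)"
    "\<And>t. t \<in> {0..1} - S \<Longrightarrow> \<bar>h' t\<bar> \<le> norm (vector_derivative g (at t)) / Im (g t)"
    by metis
  have "continuous_on {0..1} (\<lambda>t. mink N (lift (g t)))"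
    unfolding mink_def lift_def fst_conv snd_conv
    using Im by (intro continuous_intros cont ballI) (simp_all add: less_imp_neq[symmetric])
  then have "continuous_on {0..1} h"
    unfolding h_def using N(2)[OF Im] by (intro continuous_on_ln) (simp_all add: less_imp_neq[symmetric])
  then have "(h' has_integral h 1 - h 0) {0..1}"
    using S(1) h'(1)
    by (intro fundamental_theorem_of_calculus_interior_strong[of S])
       (auto simp: has_real_derivative_iff_has_vector_derivative)
  then have "((\<lambda>t. - h' t) has_integral h 0 - h 1) {0..1}"
    by (metis has_integral_neg minus_diff_eq)
  \<comment> \<open>On the finite set \<open>S\<close> nothing is known about \<open>h'\<close>. There its value is replaced by the
    integrand of the length, so that the comparison holds at every \<open>t\<close>.\<close>
  then have *: "((\<lambda>t. if t \<in> S then norm (vector_derivative g (at t)) / Im (g t) else - h' t)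
      has_integral h 0 - h 1) {0..1}"
    by (rule has_integral_spike_finite[OF S(1), rotated]) auto
  have "h 0 - h 1 \<le> l"
  proof (rule has_integral_le[OF *])
    show "((\<lambda>t. norm (vector_derivative g (at t)) / Im (g t)) has_integral l) {0..1}"
      using g(3) by (simp add: has_hyp_length_def)
  next
    fix t :: real assume "t \<in> {0..1}"
    then show "(if t \<in> S then norm (vector_derivative g (at t)) / Im (g t) else - h' t)
        \<le> norm (vector_derivative g (at t)) / Im (g t)"
      using h'(2)[of t] by auto
  qed
  then show ?thesis
    by (simp add: h_def pathstart_def pathfinish_def)
qed

lemma has_hyp_length_geod:
  assumes UV: "unit_tangent X V" and "L \<ge> 0"
  obtains g where "valid_path g" "path_image g \<subseteq> upper_half_plane"
    "pathstart g = geod X V 0" "pathfinish g = geod X V L" "has_hyp_length g L"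
proof -
  obtain D where D: "\<And>t. (geod X V has_vector_derivative D t) (at t)"
    "\<And>t. norm (D t) = Im (geod X V t)" "continuous_on UNIV D"
    using geod_unit_speed[OF UV] by blast
  define g where "g = (\<lambda>t. geod X V (L * t))"
  have g': "(g has_vector_derivative L *\<^sub>R D (L * t)) (at t)" for t
    unfolding g_def
    by (rule vector_diff_chain_at[of "\<lambda>t. L * t" L t "geod X V", unfolded o_def])
       (auto intro!: derivative_eq_intros D simp: has_real_derivative_iff_has_vector_derivative[symmetric])
  have "g C1_differentiable_on {0..1}"
    unfolding C1_differentiable_on_def using g'
    by (intro exI[of _ "\<lambda>t. L *\<^sub>R D (L * t)"])
       (auto intro!: continuous_intros continuous_on_compose2[OF D(3)])
  then have "valid_path g"
    by (simp add: valid_path_def C1_differentiable_imp_piecewise)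
  moreover have "norm (vector_derivative g (at t)) / Im (g t) = L" for t
    using Im_geod_pos[OF UV, of "L * t"] \<open>L \<ge> 0\<close> vector_derivative_at[OF g', of t]
    by (simp add: D(2) g_def)
  then have "has_hyp_length g L"
    using has_integral_const_real[of L 0 1] by (simp add: has_hyp_length_def)
  ultimately show ?thesis
    using that[of g] Im_geod_pos[OF UV]
    by (auto simp: pathstart_def pathfinish_def g_def path_image_def upper_half_plane_def)
qed

lemma connecting_geodesic:
  assumes "z \<in> upper_half_plane" "w \<in> upper_half_plane" "z \<noteq> w"
    and L: "L = arcosh (mink (lift z) (lift w))"
  obtains V where "unit_tangent (lift z) V" "geod (lift z) V 0 = z" "geod (lift z) V L = w" "L > 0"
proof -
  have zw: "Im z > 0" "Im w > 0"
    using assms by (auto simp: upper_half_plane_def)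
  have gt1: "mink (lift z) (lift w) > 1"
    using zw \<open>z \<noteq> w\<close> by (simp add: mink_lift_lift)
  have "L > 0"
    using gt1 arcosh_real_strict_mono[of 1 "mink (lift z) (lift w)"] by (simp add: L)
  moreover have "mink (lift z) (lift w) = cosh L"
    using gt1 by (simp add: L)
  ultimately obtain V where V: "unit_tangent (lift z) V" "ray (lift z) V L = lift w"
    using ray_connecting mink_lift_self fst_lift_pos zw by metis
  have "geod (lift z) V 0 = z" "geod (lift z) V L = w"
    using V zw by (simp_all add: geod_def unlift_lift) (simp add: ray_def unlift_lift)
  then show ?thesis
    using that V \<open>L > 0\<close> by blast
qed

text \<open>The infimum is attained by the geodesic. Along it the form with \<open>N = lift z + V\<close> is
  \<open>exp (- t)\<close>, so the logarithmic bound is sharp.\<close>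

theorem hyp_dist_eq:
  assumes "z \<in> upper_half_plane" "w \<in> upper_half_plane"
  shows "hyp_dist z w = arcosh (mink (lift z) (lift w))"
proof -
  define L where "L = arcosh (mink (lift z) (lift w))"
  define lengths where "lengths = {l. \<exists>g. valid_path g \<and> path_image g \<subseteq> upper_half_plane \<and>
     pathstart g = z \<and> pathfinish g = w \<and> has_hyp_length g l}"
  have zw: "Im z > 0" "Im w > 0"
    using assms by (auto simp: upper_half_plane_def)
  have "L \<in> lengths \<and> (\<forall>l\<in>lengths. L \<le> l)"
  proof (cases "z = w")
    case True
    then have "L = 0"
      using zw by (simp add: L_def mink_lift_self)
    moreover have "valid_path (\<lambda>t::real. z)" "has_hyp_length (\<lambda>t. z) 0"
      by (auto simp: valid_path_def has_hyp_length_def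
          intro!: C1_differentiable_imp_piecewise)
    then have "0 \<in> lengths"
      using True assms
      by (auto simp: lengths_def path_image_def pathstart_def pathfinish_def intro!: exI[of _ "\<lambda>t. z"])
    moreover have "0 \<le> l" if l: "l \<in> lengths" for l
    proof -
      obtain g where "path_image g \<subseteq> upper_half_plane"
        "((\<lambda>t. norm (vector_derivative g (at t)) / Im (g t)) has_integral l) {0..1}"
        using l unfolding lengths_def has_hyp_length_def by blast
      then show ?thesis
        by (elim has_integral_nonneg) (force simp: path_image_def upper_half_plane_def)
    qed
    ultimately show ?thesis by simp
  next
    case False
    then obtain V where V: "unit_tangent (lift z) V" "geod (lift z) V 0 = z"
        "geod (lift z) V L = w" "L > 0"
      using connecting_geodesic assms L_def by metis
    define N where "N = lift z + V"
    have N: "mink N N = 0" "mink N (lift z) = 1"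
      using V(1) by (simp_all add: unit_tangent_def N_def mink_bilinear mink_commute[of V "lift z"])
    have "mink N (lift w) = cosh L - sinh L"
      using V(1) lift_geod[OF V(1), of L]
      by (simp add: V(3) N_def ray_def unit_tangent_def mink_bilinear mink_commute[of V "lift z"])
    then have Nw: "mink N (lift w) = exp (- L)"
      by (simp add: cosh_minus_sinh)
    have "L \<le> l" if l: "l \<in> lengths" for l
    proof -
      obtain g where g: "valid_path g" "path_image g \<subseteq> upper_half_plane" "pathstart g = z"
        "pathfinish g = w" "has_hyp_length g l"
        using l by (auto simp: lengths_def)
      have "mink N (lift u) > 0" if "Im u > 0" for u
        using null_vector_pos[of N "lift z" "lift u"] N zw that
        by (simp add: mink_lift_self fst_lift_pos)
      then show ?thesis
        using length_ge_log_null_form[OF N(1) _ g(1,2,5)] by (simp add: g N Nw)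
    qed
    moreover have "L \<in> lengths"
      using has_hyp_length_geod[OF V(1), of L] V by (auto simp: lengths_def)
    ultimately show ?thesis by blast
  qed
  then have "Inf lengths = L"
    by (intro cInf_eq_minimum) auto
  then show ?thesis
    by (simp add: hyp_dist_def lengths_def L_def)
qed


corollary cosh_hyp_dist:
  assumes "z \<in> upper_half_plane" "w \<in> upper_half_plane"
  shows "cosh (hyp_dist z w) = mink (lift z) (lift w)" and "hyp_dist z w \<ge> 0"
proof -
  have "mink (lift z) (lift w) \<ge> 1"
    using assms by (simp add: mink_lift_lift upper_half_plane_def)
  then show "cosh (hyp_dist z w) = mink (lift z) (lift w)" "hyp_dist z w \<ge> 0"
    by (simp_all add: hyp_dist_eq[OF assms])
qed

corollary hyp_dist_le_iff:
  assumes "z \<in> upper_half_plane" "w \<in> upper_half_plane" "r \<ge> 0"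
  shows "hyp_dist z w \<le> r \<longleftrightarrow> mink (lift z) (lift w) \<le> cosh r"
  using cosh_hyp_dist[OF assms(1,2)] assms(3) by (metis cosh_real_nonneg_le_iff)

lemma geod_mem: "unit_tangent X V \<Longrightarrow> geod X V t \<in> upper_half_plane"
  by (simp add: Im_geod_pos upper_half_plane_def)

lemma hyp_dist_geod: "unit_tangent X V \<Longrightarrow> hyp_dist (geod X V s) (geod X V t) = \<bar>s - t\<bar>"
  using arcosh_cosh_real[of "\<bar>s - t\<bar>"]
  by (simp add: hyp_dist_eq geod_mem lift_geod mink_ray_ray cosh_real_abs)

lemma is_geodesic_arc_geod:
  assumes "unit_tangent X V" "L \<ge> 0"
  shows "is_geodesic_arc (geod X V ` {0..L}) (geod X V 0) (geod X V L)"
  unfolding is_geodesic_arc_def using assms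
  by (intro exI[of _ "geod X V"]) (auto simp: hyp_dist_geod geod_mem)

text \<open>Equality in the triangle inequality determines the arc, and \<open>geodesic_to_translate\<close>
  extracts its equation from it.\<close>

lemma geodesic_arc_additive:
  assumes "is_geodesic_arc r z w" "u \<in> r"
  shows "u \<in> upper_half_plane" "hyp_dist z u + hyp_dist u w = hyp_dist z w"
proof -
  obtain c where c: "c ` {0..hyp_dist z w} = r" "r \<subseteq> upper_half_plane" "c 0 = z"
      "c (hyp_dist z w) = w"
      "\<And>s t. s\<in>{0..hyp_dist z w} \<Longrightarrow> t\<in>{0..hyp_dist z w} \<Longrightarrow> hyp_dist (c s) (c t) = \<bar>s - t\<bar>"
    using assms(1) unfolding is_geodesic_arc_def by blast
  obtain s where s: "s \<in> {0..hyp_dist z w}" "u = c s"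
    using c(1) assms(2) by blast
  show "u \<in> upper_half_plane"
    using c(2) assms(2) by blast
  show "hyp_dist z u + hyp_dist u w = hyp_dist z w"
    using c(5)[of 0 s] c(5)[of s "hyp_dist z w"] s c(3,4) by auto
qed

section \<open>The orbit of \<open>\<i>\<close>\<close>

text \<open>For \<open>z = (a\<i> + b)/(c\<i> + d)\<close> the coordinates are the entries of the Gram matrix of the
  rows \<open>(c, d)\<close> and \<open>(a, b)\<close>, whose determinant is the square of the
  determinant of the matrix. If \<open>k = 0\<close>, then \<open>m p = 1\<close> forces \<open>z = \<i>\<close>.\<close>

lemma orbit_i_starE:
  assumes "z \<in> orbit_i_star"
  obtains m k p :: int where "z \<in> upper_half_plane" "lift z = (of_int m, of_int k, of_int p)"
    "m > 0" "p > 0" "m * p = k\<^sup>2 + 1" "k \<noteq> 0"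
proof -
  obtain A where A: "A \<in> SL2Z" "z = moebius_act A \<i>" and "z \<noteq> \<i>"
    using assms by (auto simp: orbit_i_star_def orbit_i_def)
  define a b c d where abcd: "a = A $ 1 $ 1" "b = A $ 1 $ 2" "c = A $ 2 $ 1" "d = A $ 2 $ 2"
  have det: "a * d - b * c = 1"
    using A(1) by (simp add: SL2Z_def det_2 abcd)
  define m k p where "m = c\<^sup>2 + d\<^sup>2" and "k = a * c + b * d" and "p = a\<^sup>2 + b\<^sup>2"
  have "m * p = k\<^sup>2 + (a * d - b * c)\<^sup>2"
    by (simp add: m_def k_def p_def algebra_simps power2_eq_square)
  then have mp: "m * p = k\<^sup>2 + 1"
    by (simp add: det)
  have "m * p \<noteq> 0"
    unfolding mp using zero_le_power2[of k] by linarith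
  then have "m \<noteq> 0" "p \<noteq> 0"
    by auto
  moreover have "m \<ge> 0" "p \<ge> 0"
    by (simp_all add: m_def p_def)
  ultimately have pos: "m > 0" "p > 0"
    by simp_all
  have det': "of_int a * of_int d - of_int b * of_int c = (1 :: real)"
    using det by (metis of_int_1 of_int_diff of_int_mult)
  have "z = (of_int a * \<i> + of_int b) / (of_int c * \<i> + of_int d)"
    by (simp add: A(2) moebius_act_def abcd)
  then have z: "Re z = of_int k / of_int m" "Im z = 1 / of_int m"
    using det' by (simp_all add: Re_divide Im_divide m_def k_def algebra_simps)
  have "((Re z)\<^sup>2 + (Im z)\<^sup>2) / Im z = of_int (k\<^sup>2 + 1) / of_int m"
    using pos by (simp add: z field_simps power2_eq_square)
  also have "\<dots> = of_int p"
    using pos by (simp flip: mp)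
  finally have "lift z = (of_int m, of_int k, of_int p)"
    using pos by (simp add: lift_def) (simp add: z)
  moreover have "k \<noteq> 0"
  proof
    assume "k = 0"
    then have "m = 1"
      using mp pos by (simp add: zmult_eq_1_iff)
    then show False
      using \<open>z \<noteq> \<i>\<close> \<open>k = 0\<close> z by (simp add: complex_eq_iff)
  qed
  moreover have "z \<in> upper_half_plane"
    using z pos by (simp add: upper_half_plane_def)
  ultimately show ?thesis
    using that pos mp by blast
qed

lemma orbit_i_starI:
  fixes a b c d :: int
  assumes "a * d - b * c = 1" "z = (of_int a * \<i> + of_int b) / (of_int c * \<i> + of_int d)" "z \<noteq> \<i>"
  shows "z \<in> orbit_i_star"
proof -
  define A :: "int^2^2" where
    "A = (\<chi> i j. if i = 1 then if j = 1 then a else b else if j = 1 then c else d)"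
  have "A \<in> SL2Z" "moebius_act A \<i> = z"
    using assms by (simp_all add: A_def SL2Z_def det_2 moebius_act_def)
  then show ?thesis
    using assms(3) by (auto simp: orbit_i_star_def orbit_i_def)
qed

lemma i_mem: "\<i> \<in> upper_half_plane" and lift_i: "lift \<i> = (1, 0, 1)"
  by (simp_all add: upper_half_plane_def lift_def)

text \<open>The form of \<open>lift \<i>\<close> and \<open>(m, k, p)\<close> is \<open>(m + p)/2\<close>, and \<open>m p = k\<^sup>2 + 1 \<ge> 2\<close>.\<close>

lemma orbit_i_star_cosh_ge:
  assumes "z \<in> orbit_i_star"
  shows "cosh (hyp_dist \<i> z) \<ge> 3 / 2"
proof -
  obtain m k p :: int where z: "z \<in> upper_half_plane" "lift z = (of_int m, of_int k, of_int p)"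
    "m > 0" "p > 0" "m * p = k\<^sup>2 + 1" "k \<noteq> 0"
    using orbit_i_starE[OF assms] .
  have "k\<^sup>2 > 0" using z(6) by simp
  then have "m * p \<noteq> 1"
    using z(5) by simp
  then have "m + p \<ge> 3"
    using z(3,4) by (cases "m = 1"; cases "p = 1") auto
  then have "real_of_int m + real_of_int p \<ge> 3"
    by linarith
  then show ?thesis
    by (simp add: cosh_hyp_dist i_mem z lift_i mink_def)
qed

section \<open>Sufficiency of the radius \<open>ln (1 + \<surd>2)\<close>\<close>

lemma cosh_sinh_half_ln_2: "cosh (ln 2 / 2) = 3 / 4 * sqrt 2" "sinh (ln 2 / 2) = sqrt 2 / 4"
proof -
  have "exp (ln 2 / 2) = sqrt 2"
    by (simp flip: ln_sqrt)
  then show "cosh (ln 2 / 2) = 3 / 4 * sqrt 2" "sinh (ln 2 / 2) = sqrt 2 / 4"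
    by (simp_all add: cosh_def sinh_def exp_minus field_simps)
qed

definition nearest_orbit_points :: "complex set" where
  "nearest_orbit_points = {1 + \<i>, -1 + \<i>, (1 + \<i>) / 2, (-1 + \<i>) / 2}"

lemma lift_nearest:
  "lift (1 + \<i>) = (1, 1, 2)" "lift (-1 + \<i>) = (1, -1, 2)"
  "lift ((1 + \<i>) / 2) = (2, 1, 1)" "lift ((-1 + \<i>) / 2) = (2, -1, 1)"
  by (simp_all add: lift_def power2_eq_square)

lemma nearest_orbit_points:
  assumes "z \<in> nearest_orbit_points"
  shows "z \<in> orbit_i_star" "z \<in> upper_half_plane" "mink (lift \<i>) (lift z) = 3 / 2"
proof -
  have "1 + \<i> \<in> orbit_i_star"
    by (rule orbit_i_starI[of 1 1 1 0]) (auto simp: complex_eq_iff)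
  moreover have "-1 + \<i> \<in> orbit_i_star"
    by (rule orbit_i_starI[of 1 1 "-1" 0]) (auto simp: complex_eq_iff)
  moreover have "(1 + \<i>) / 2 \<in> orbit_i_star"
    by (rule orbit_i_starI[of 1 1 0 1]) (auto simp: complex_eq_iff Re_divide Im_divide)
  moreover have "(-1 + \<i>) / 2 \<in> orbit_i_star"
    by (rule orbit_i_starI[of 1 1 0 "-1"]) (auto simp: complex_eq_iff Re_divide Im_divide)
  ultimately show "z \<in> orbit_i_star"
    using assms unfolding nearest_orbit_points_def by blast
  have "\<forall>z\<in>nearest_orbit_points. z \<in> upper_half_plane \<and> mink (lift \<i>) (lift z) = 3 / 2"
    unfolding nearest_orbit_points_def ball_simps lift_nearest lift_i
    by (simp add: upper_half_plane_def mink_def)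
  then show "z \<in> upper_half_plane" "mink (lift \<i>) (lift z) = 3 / 2"
    using assms by blast+
qed

text \<open>A unit tangent vector at \<open>\<i>\<close> has the form \<open>(-vc, vb, vc)\<close> with \<open>vb\<^sup>2 + vc\<^sup>2 = 1\<close>. The signs of
  \<open>vb\<close> and \<open>vc\<close> determine the quadrant of the ray, hence the nearest point \<open>z\<close> to compare with. Its form
  with \<open>V\<close> is \<open>- \<bar>vc\<bar>/2 - \<bar>vb\<bar>\<close>, which is at most \<open>-1/2\<close> since \<open>\<bar>vc\<bar> + \<bar>vb\<bar> \<ge> 1\<close>. Equality
  holds for the vertical rays. The time \<open>(ln 2)/2\<close> is where \<open>tanh t = 1/3\<close>, the minimum of
  \<open>3/2 cosh t - 1/2 sinh t\<close>.\<close>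

lemma ray_meets_ball_of_nearest:
  assumes "unit_tangent (lift \<i>) V"
  obtains z where "z \<in> nearest_orbit_points"
    "mink (ray (lift \<i>) V (ln 2 / 2)) (lift z) \<le> sqrt 2"
proof -
  obtain va vb vc where V: "V = (va, vb, vc)"
    by (cases V) auto
  have va: "va = - vc" and "va * vc - vb * vb = -1"
    using assms by (simp_all add: unit_tangent_def V lift_i mink_def)
  then have circ: "vc\<^sup>2 + vb\<^sup>2 = 1"
    by (simp add: power2_eq_square)
  have "(\<bar>vc\<bar> + \<bar>vb\<bar>)\<^sup>2 \<ge> 1"
    using circ by (simp add: power2_sum)
  then have ge: "\<bar>vc\<bar> + \<bar>vb\<bar> \<ge> 1"
    using abs_le_square_iff[of 1 "\<bar>vc\<bar> + \<bar>vb\<bar>"] by simp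
  define z where "z = (if vc \<ge> 0 then if vb \<ge> 0 then 1 + \<i> else -1 + \<i>
    else if vb \<ge> 0 then (1 + \<i>) / 2 else (-1 + \<i>) / 2)"
  have z: "z \<in> nearest_orbit_points"
    by (simp add: z_def nearest_orbit_points_def)
  have "lift z = (if vc \<ge> 0 then if vb \<ge> 0 then (1, 1, 2) else (1, -1, 2)
      else if vb \<ge> 0 then (2, 1, 1) else (2, -1, 1))"
    unfolding z_def if_distrib[of lift] lift_nearest by simp
  then have "mink V (lift z) = - \<bar>vc\<bar> / 2 - \<bar>vb\<bar>"
    by (simp add: V mink_def va)
  then have *: "mink V (lift z) \<le> - 1 / 2"
    using ge by linarith
  define t where "t = ln 2 / (2 :: real)"
  have ch: "cosh t = 3 / 4 * sqrt 2" "sinh t = sqrt 2 / 4"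
    unfolding t_def by (fact cosh_sinh_half_ln_2)+
  have "mink (ray (lift \<i>) V t) (lift z) = 3 / 2 * cosh t + sinh t * mink V (lift z)"
    using nearest_orbit_points(3)[OF z] by (simp add: ray_def mink_bilinear)
  also have "\<dots> \<le> 3 / 2 * cosh t + sinh t * (- 1 / 2)"
    using * by (intro add_left_mono mult_left_mono) (auto simp: ch)
  also have "\<dots> = sqrt 2"
    by (simp add: ch)
  finally show ?thesis
    using that z by (simp add: t_def)
qed

lemma cosh_ln_one_plus_sqrt2: "cosh (ln (1 + sqrt 2)) = sqrt 2"
proof -
  have "inverse (1 + sqrt 2) = sqrt 2 - 1"
    by (rule inverse_unique) (simp add: algebra_simps)
  moreover have "1 + sqrt 2 > 0"
    by (simp add: add_pos_pos)
  ultimately show ?thesis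
    by (simp add: cosh_def exp_minus)
qed

lemma all_eclipsed_if_ge:
  assumes "R \<ge> 0" "C_star R \<noteq> {}" "\<epsilon> \<ge> ln (1 + sqrt 2)"
    and w: "w \<in> orbit_i_star" "hyp_dist \<i> w > R"
  shows "\<exists>z\<in>C_star R. eclipses z \<epsilon> w"
proof -
  have ln_nonneg: "ln (1 + sqrt 2) \<ge> 0"
    by (rule ln_ge_zero) simp
  then have \<epsilon>: "\<epsilon> \<ge> 0"
    using assms(3) by linarith
  then have "cosh \<epsilon> \<ge> cosh (ln (1 + sqrt 2))"
    using assms(3) ln_nonneg by (simp only: cosh_real_nonneg_le_iff)
  then have cosh\<epsilon>: "cosh \<epsilon> \<ge> sqrt 2"
    by (simp only: cosh_ln_one_plus_sqrt2)
  obtain z0 where z0: "z0 \<in> orbit_i_star" "z0 \<in> upper_half_plane" "hyp_dist \<i> z0 \<le> R"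
    using assms(2) by (auto simp: C_star_def)
  have coshR: "cosh R \<ge> 3 / 2"
    using orbit_i_star_cosh_ge[OF z0(1)] z0(3) cosh_hyp_dist(2)[OF i_mem z0(2)]
    by (meson cosh_real_nonneg_le_iff order_trans)
  have wH: "w \<in> upper_half_plane"
    using orbit_i_starE[OF w(1)] by blast
  define L where "L = hyp_dist \<i> w"
  have "w \<noteq> \<i>" "L \<ge> R"
    using w by (auto simp: orbit_i_star_def L_def)
  obtain V where V: "unit_tangent (lift \<i>) V" "geod (lift \<i>) V 0 = \<i>" "geod (lift \<i>) V L = w" "L > 0"
    using connecting_geodesic[OF i_mem wH] \<open>w \<noteq> \<i>\<close> hyp_dist_eq[OF i_mem wH] L_def by metis
  obtain z where z: "z \<in> nearest_orbit_points"
      "mink (ray (lift \<i>) V (ln 2 / 2)) (lift z) \<le> sqrt 2"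
    using ray_meets_ball_of_nearest[OF V(1)] .
  define t where "t = ln 2 / (2::real)"
  have "t \<le> L"
  proof -
    have "cosh t = 3 / 4 * sqrt 2"
      unfolding t_def by (fact cosh_sinh_half_ln_2)
    also have "\<dots> \<le> 3 / 4 * 2"
      by (intro mult_left_mono) (auto simp: sqrt_le_D real_le_lsqrt)
    also have "\<dots> \<le> cosh R"
      using coshR by simp
    finally show ?thesis
      using \<open>L \<ge> R\<close> assms(1) by (simp add: cosh_real_nonneg_le_iff t_def)
  qed
  let ?u = "geod (lift \<i>) V t"
  have "?u \<in> geod (lift \<i>) V ` {0..L}"
    using \<open>t \<le> L\<close> by (simp add: t_def)
  moreover have "?u \<in> hyp_cball z \<epsilon>"
    using z cosh\<epsilon> nearest_orbit_points(2)[OF z(1)] \<epsilon>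
    by (simp add: hyp_cball_def geod_mem V(1) hyp_dist_le_iff lift_geod t_def)
  ultimately have "eclipses z \<epsilon> w"
    using is_geodesic_arc_geod[OF V(1), of L] V unfolding eclipses_def by auto
  moreover have "z \<in> C_star R"
    using nearest_orbit_points[OF z(1)] coshR assms(1)
    by (simp add: C_star_def hyp_dist_le_iff i_mem)
  ultimately show ?thesis by blast
qed

section \<open>Necessity of the radius \<open>ln (1 + \<surd>2)\<close>\<close>

text \<open>Equality in the triangle inequality says that the Gram determinant
  \<open>1 + 2ABC - A\<^sup>2 - B\<^sup>2 - C\<^sup>2\<close> of the coordinate vectors of \<open>\<i>\<close>, \<open>u\<close> and \<open>n + \<i>\<close>
  vanishes. It is the square of their determinant, up to a factor, hence the linear equation, which
  describes the circle \<open>\<bar>u\<bar>\<^sup>2 - n Re u = 1\<close> through \<open>\<i>\<close> and \<open>n + \<i>\<close> orthogonal to the real axis.\<close>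

lemma geodesic_to_translate:
  fixes n :: real
  assumes u: "u \<in> upper_half_plane" "lift u = (a, b, c)"
    and add: "hyp_dist \<i> u + hyp_dist u (of_real n + \<i>) = hyp_dist \<i> (of_real n + \<i>)" and "n > 0"
  shows "n * b = c - a"
proof -
  have w: "of_real n + \<i> \<in> upper_half_plane" "lift (of_real n + \<i>) = (1, n, n\<^sup>2 + 1)"
    by (simp_all add: upper_half_plane_def lift_def)
  define A where "A = (a + c) / 2"
  define B where "B = (a * (n\<^sup>2 + 1) + c) / 2 - b * n"
  define C where "C = 1 + n\<^sup>2 / 2"
  have A: "cosh (hyp_dist \<i> u) = A" and B: "cosh (hyp_dist u (of_real n + \<i>)) = B"
    and C: "cosh (hyp_dist \<i> (of_real n + \<i>)) = C"
    unfolding cosh_hyp_dist(1)[OF i_mem u(1)] cosh_hyp_dist(1)[OF u(1) w(1)]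
      cosh_hyp_dist(1)[OF i_mem w(1)] u(2) w(2) lift_i A_def B_def C_def
    by (simp_all add: mink_def field_simps)
  have ac: "c * a = 1 + b\<^sup>2"
    using mink_lift_self[of u] u by (simp add: upper_half_plane_def mink_def power2_eq_square field_simps)
  have "C = A * B + sinh (hyp_dist \<i> u) * sinh (hyp_dist u (of_real n + \<i>))"
    using C unfolding add[symmetric] cosh_add A B by simp
  then have "(C - A * B)\<^sup>2 = (sinh (hyp_dist \<i> u))\<^sup>2 * (sinh (hyp_dist u (of_real n + \<i>)))\<^sup>2"
    by (simp add: power_mult_distrib)
  also have "\<dots> = (A\<^sup>2 - 1) * (B\<^sup>2 - 1)"
    by (simp add: sinh_square_eq A B)
  finally have "1 + 2 * A * B * C - A\<^sup>2 - B\<^sup>2 - C\<^sup>2 = 0"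
    by (simp add: power2_eq_square algebra_simps)
  moreover have "1 + 2 * A * B * C - A\<^sup>2 - B\<^sup>2 - C\<^sup>2 = (n / 2 * (c - a - n * b))\<^sup>2"
  proof -
    \<comment> \<open>The Gram determinant with the self-product of \<open>u\<close> kept as \<open>c a - b\<^sup>2\<close> is a square
      identically.\<close>
    have "(c * a - b\<^sup>2) * (1 - C\<^sup>2) + 2 * A * B * C - A\<^sup>2 - B\<^sup>2 = (n / 2 * (c - a - n * b))\<^sup>2"
    proof -
      define h where "h = n / 2"
      have subst: "n = 2 * h" "c = 2 * A - a" "B = A + 2 * h\<^sup>2 * a - 2 * h * b" "C = 1 + 2 * h\<^sup>2"
        by (simp_all add: h_def A_def B_def C_def field_simps power2_eq_square)
      show ?thesis
        unfolding subst by (simp add: algebra_simps power2_eq_square)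
    qed
    then show ?thesis
      unfolding ac by simp
  qed
  ultimately show ?thesis
    using \<open>n > 0\<close> by simp
qed

text \<open>A substitute for the triangle inequality at the base point \<open>\<i>\<close>, whose coordinates are
  \<open>(1, 0, 1)\<close>: it is \<open>cosh (r + s) \<le> 2 cosh r cosh s\<close>, and it follows from
  the positive semidefiniteness of \<open>a x\<^sup>2 - 2 b x y + c y\<^sup>2\<close>.\<close>

lemma mink_triangle:
  assumes "m * p = k\<^sup>2 + 1" "a > 0" "a * c = b\<^sup>2 + 1"
  shows "mink (1, 0, 1) (a, b, c) \<le> 2 * mink (1, 0, 1) (m, k, p) * mink (m, k, p) (a, b, c)"
proof -
  have psd: "a * x\<^sup>2 - 2 * b * x * y + c * y\<^sup>2 \<ge> 0" for x y
  proof -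
    have "a * (a * x\<^sup>2 - 2 * b * x * y + c * y\<^sup>2) = (a * x - b * y)\<^sup>2 + (a * c - b\<^sup>2) * y\<^sup>2"
      by (simp add: power2_eq_square algebra_simps)
    also have "\<dots> \<ge> 0"
      using assms(3) by simp
    finally show ?thesis
      using assms(2) by (simp add: zero_le_mult_iff)
  qed
  have "2 * mink (1, 0, 1) (m, k, p) * mink (m, k, p) (a, b, c) - mink (1, 0, 1) (a, b, c)
      = ((a * p\<^sup>2 - 2 * b * p * k + c * k\<^sup>2) + (a * k\<^sup>2 - 2 * b * k * m + c * m\<^sup>2)
         + (a + c) * (m * p - k\<^sup>2 - 1)) / 2"
    by (simp add: mink_def power2_eq_square field_simps)
  also have "\<dots> \<ge> 0"
    using psd[of p k] psd[of k m] assms(1) by simp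
  finally show ?thesis by simp
qed

text \<open>By the arithmetic-geometric mean inequality, the form is at least
  \<open>\<surd>(1 + b\<^sup>2) \<surd>(1 + k\<^sup>2) - \<bar>b\<bar> \<bar>k\<bar> = cosh (arsinh \<bar>k\<bar> - arsinh \<bar>b\<bar>)\<close>, the hyperbolic cosine of the
  distance between two curves equidistant from the imaginary axis. For \<open>\<bar>b\<bar> \<le> 1 \<le> \<bar>k\<bar>\<close> it is
  smallest at \<open>\<bar>k\<bar> = 1\<close>. The estimate \<open>\<surd>(1 + k\<^sup>2) \<ge> (1 + \<bar>k\<bar>)/\<surd>2\<close>
  makes the dependence on \<open>k\<close> linear.\<close>

lemma mink_ge_near_axis:
  assumes "m > 0" "m * p = k\<^sup>2 + 1" "\<bar>k\<bar> \<ge> 1" "a > 0" "a * c = b\<^sup>2 + 1" "\<bar>b\<bar> \<le> 1"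
  shows "mink (a, b, c) (m, k, p) \<ge> sqrt 2 - \<bar>b\<bar>"
proof -
  have pc: "p > 0" "c > 0"
    using assms by (smt (verit) zero_less_mult_pos zero_le_power2)+
  have "sqrt 2 + (\<bar>k\<bar> - 1) * \<bar>b\<bar> \<le> sqrt 2 * sqrt (b\<^sup>2 + 1) + (\<bar>k\<bar> - 1) * (sqrt (b\<^sup>2 + 1) / sqrt 2)"
  proof (intro add_mono mult_left_mono)
    have "(sqrt 2 * \<bar>b\<bar>)\<^sup>2 \<le> b\<^sup>2 + 1"
      using assms(6) by (simp add: power_mult_distrib abs_square_le_1)
    then have "sqrt 2 * \<bar>b\<bar> \<le> sqrt (b\<^sup>2 + 1)"
      by (rule real_le_rsqrt)
    then show "\<bar>b\<bar> \<le> sqrt (b\<^sup>2 + 1) / sqrt 2"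
      by (simp add: field_simps)
  qed (use assms in auto)
  also have "\<dots> = sqrt (b\<^sup>2 + 1) * ((1 + \<bar>k\<bar>) / sqrt 2)"
    by (simp add: field_simps)
  also have "\<dots> \<le> sqrt (b\<^sup>2 + 1) * sqrt (k\<^sup>2 + 1)"
  proof (intro mult_left_mono)
    have "((1 + \<bar>k\<bar>) / sqrt 2)\<^sup>2 \<le> k\<^sup>2 + 1"
      using zero_le_power2[of "1 - \<bar>k\<bar>"]
      by (simp add: power_divide power2_sum power2_diff)
    then show "(1 + \<bar>k\<bar>) / sqrt 2 \<le> sqrt (k\<^sup>2 + 1)"
      by (rule real_le_rsqrt)
  qed simp
  also have "\<dots> = sqrt ((a * p) * (c * m))"
    by (simp add: assms(2,5)[symmetric] mult_ac flip: real_sqrt_mult)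
  also have "\<dots> \<le> (a * p + c * m) / 2"
    using assms pc by (intro arith_geo_mean_sqrt) auto
  finally have "sqrt 2 - \<bar>b\<bar> \<le> (a * p + c * m) / 2 - \<bar>b\<bar> * \<bar>k\<bar>"
    by (simp add: algebra_simps)
  also have "\<dots> \<le> (a * p + c * m) / 2 - b * k"
    by (simp flip: abs_mult)
  finally show ?thesis
    by (simp add: mink_def algebra_simps)
qed

lemma not_all_eclipsed_if_less:
  assumes "R \<ge> 0" "0 \<le> \<epsilon>" "\<epsilon> < ln (1 + sqrt 2)"
  shows "\<exists>w\<in>orbit_i_star. hyp_dist \<i> w > R \<and> \<not> (\<exists>z\<in>C_star R. eclipses z \<epsilon> w)"
proof -
  have "cosh \<epsilon> < cosh (ln (1 + sqrt 2))"
    using assms by (simp add: cosh_real_nonneg_less_iff)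
  then have \<delta>: "sqrt 2 - cosh \<epsilon> > 0"
    by (simp add: cosh_ln_one_plus_sqrt2)
  \<comment> \<open>Any point within \<open>\<epsilon>\<close> of a point of \<open>C_star R\<close> has \<open>a + c \<le> K\<close>, and then the
    equation of the arc gives \<open>\<bar>b\<bar> \<le> K / n\<close>.\<close>
  define K where "K = 4 * cosh R * cosh \<epsilon>"
  have "cosh R \<ge> 1" "cosh \<epsilon> \<ge> 1"
    by (simp_all add: cosh_real_ge_1)
  then have K: "K \<ge> 4 * cosh R" "K \<ge> 4"
    using mult_mono[of 1 "cosh R" 1 "cosh \<epsilon>"] by (simp_all add: K_def)
  obtain n :: nat where n: "real n > max K (K / (sqrt 2 - cosh \<epsilon>))"
    using reals_Archimedean2 by blast
  then have n1: "real n > K" and n2: "K / real n < sqrt 2 - cosh \<epsilon>"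
    using \<delta> K by (auto simp: field_simps)
  have npos: "real n > 0" using n1 K by linarith
  define w where "w = of_real (real n) + \<i>"
  have w: "w \<in> upper_half_plane" "lift w = (1, real n, (real n)\<^sup>2 + 1)"
    by (simp_all add: w_def upper_half_plane_def lift_def)
  have "w \<in> orbit_i_star"
    using npos by (intro orbit_i_starI[of 1 1 "int n" 0]) (auto simp: w_def complex_eq_iff)
  moreover have "hyp_dist \<i> w > R"
  proof -
    have "cosh R < 1 + real n * real n / 2"
      using n1 K mult_mono[of 2 "real n" "real n" "real n"] by linarith
    also have "\<dots> = mink (lift \<i>) (lift w)"
      by (simp add: lift_i w mink_def power2_eq_square)
    finally show ?thesis
      using hyp_dist_le_iff[OF i_mem w(1) assms(1)] by linarith
  qed
  moreover have False if z: "z \<in> C_star R" and ecl: "eclipses z \<epsilon> w" for z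
  proof -
    have zorb: "z \<in> orbit_i_star" and zR: "hyp_dist \<i> z \<le> R"
      using z by (auto simp: C_star_def)
    obtain m k p :: int where zH: "z \<in> upper_half_plane" and
      lz: "lift z = (of_int m, of_int k, of_int p)"
      and mkp: "m > 0" "m * p = k\<^sup>2 + 1" "k \<noteq> 0"
      using orbit_i_starE[OF zorb] by metis
    obtain r u where r: "is_geodesic_arc r \<i> w" "u \<in> r" and uz: "hyp_dist u z \<le> \<epsilon>"
      using ecl by (auto simp: eclipses_def hyp_cball_def)
    note u = geodesic_arc_additive[OF r]
    obtain a b c where lu: "lift u = (a, b, c)"
      by (cases "lift u") auto
    have apos: "a > 0" and ac: "a * c = b\<^sup>2 + 1"
      using u(1) lu mink_lift_self[of u] fst_lift_pos[of u]
      by (auto simp: upper_half_plane_def mink_def power2_eq_square algebra_simps)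
    have mkp': "real_of_int m > 0" "real_of_int m * real_of_int p = (real_of_int k)\<^sup>2 + 1"
        "\<bar>real_of_int k\<bar> \<ge> 1"
      using mkp by (simp_all flip: of_int_mult of_int_power of_int_abs)
    have zu: "mink (lift z) (lift u) \<le> cosh \<epsilon>"
      using uz u(1) zH assms(2) hyp_dist_le_iff[of u z \<epsilon>] by (simp add: mink_commute)
    have iz: "mink (lift \<i>) (lift z) \<le> cosh R"
      using zR zH assms(1) hyp_dist_le_iff[OF i_mem, of z R] by simp
    have "a + c = 2 * mink (lift \<i>) (lift u)"
      by (simp add: lift_i lu mink_def)
    also have "\<dots> \<le> 2 * (2 * mink (lift \<i>) (lift z) * mink (lift z) (lift u))"
      unfolding lift_i lu lz using mink_triangle[OF mkp'(2) apos ac] by simp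
    also have "\<dots> \<le> 2 * (2 * cosh R * cosh \<epsilon>)"
      using iz zu zH u(1) by (intro mult_left_mono mult_mono) (auto simp: cosh_hyp_dist(1)[symmetric])
    finally have "a + c \<le> K"
      by (simp add: K_def)
    moreover have "c > 0"
      using ac apos by (smt (verit) zero_less_mult_pos zero_le_power2)
    moreover have "real n * b = c - a"
      using geodesic_to_translate[OF u(1) lu _ npos] u(2) by (simp add: w_def)
    ultimately have "real n * \<bar>b\<bar> \<le> K"
      using apos npos abs_mult[of "real n" b] by simp
    then have b: "\<bar>b\<bar> \<le> K / real n"
      using npos by (simp add: field_simps)
    also have "\<dots> \<le> 1"
      using n1 npos by simp
    finally have "sqrt 2 - \<bar>b\<bar> \<le> mink (lift u) (lift z)"
      unfolding lu lz by (rule mink_ge_near_axis[OF mkp' apos ac])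
    also have "\<dots> \<le> cosh \<epsilon>"
      using zu by (simp add: mink_commute)
    finally show False
      using b n2 by linarith
  qed
  ultimately show ?thesis by blast
qed

theorem proposition5p4:
  fixes R \<epsilon> :: real
  assumes "R > 0" and "\<epsilon> > 0" and "C_star R \<noteq> {}"
  shows "(\<forall>w\<in>orbit_i_star. hyp_dist \<i> w > R \<longrightarrow> (\<exists>z\<in>C_star R. eclipses z \<epsilon> w))
           \<longleftrightarrow> \<epsilon> \<ge> ln (1 + sqrt 2)"
proof
  assume "\<forall>w\<in>orbit_i_star. hyp_dist \<i> w > R \<longrightarrow> (\<exists>z\<in>C_star R. eclipses z \<epsilon> w)"
  then show "\<epsilon> \<ge> ln (1 + sqrt 2)"
    using not_all_eclipsed_if_less[of R \<epsilon>] assms by (meson less_imp_le not_le)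
next
  assume "\<epsilon> \<ge> ln (1 + sqrt 2)"
  then show "\<forall>w\<in>orbit_i_star. hyp_dist \<i> w > R \<longrightarrow> (\<exists>z\<in>C_star R. eclipses z \<epsilon> w)"
    using all_eclipsed_if_ge[of R \<epsilon>] assms by auto
qed

end
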